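(* Let $\tilde v^*=(v^*,\eta^* )$ be a fixed point of the map $F$ defined in the context, let $x^*=z^*=\Pi(v^* )$, let $D=D\Pi(v^* )$, and assume that $v^*_j\notin\{l_j,u_j\}$ for all $j$ and that $I-\nabla_{\tilde v}F(\tilde v^* )$ is nonsingular. Let $\ell$ be a continuously differentiable real-valued loss function of $z^*$, with $\frac{\partial\ell}{\partial z^*}$ its (row-vector) derivative at $z^*$. Define $\hat d_x\in\mathbb{R}^{d_z}$ and $\hat d_\eta\in\mathbb{R}^{d_{eq}}$ by $$\begin{bmatrix}\hat d_x\\ \hat d_\eta\end{bmatrix}=\begin{bmatrix}Q+\rho I&A^T\\ A&0\end{bmatrix}^{-1}\big[I-\nabla_{\tilde v}F(\tilde v^* )\big]^{-T}\begin{bmatrix}D&0\\0&I_\eta\end{bmatrix}\begin{bmatrix}\big(-\frac{\partial\ell}{\partial z^*}\big)^T\\0\end{bmatrix}.$$ Then also $$\begin{bmatrix}\hat d_x\\ \hat d_\eta\end{bmatrix}=\Bigg[\begin{bmatrix}D&0\\0&I_\eta\end{bmatrix}\begin{bmatrix}Q+\rho I&A^T\\ A&0\end{bmatrix}+\begin{bmatrix}-\rho(2D-I_v)&0\\0&0\end{bmatrix}\Bigg]^{-1}\begin{bmatrix}D&0\\0&I_\eta\end{bmatrix}\begin{bmatrix}\big(-\frac{\partial\ell}{\partial z^*}\big)^T\\0\end{bmatrix},$$ and the gradients of the loss $\ell$ with respect to the problem variables $Q,p,A,b$ are $$\frac{\partial\ell}{\partial Q}=\tfrac12\big(\hat d_x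 x^{*T}+x^*\hat d_x^T\big),\qquad \frac{\partial\ell}{\partial p}=\hat d_x,\qquad \frac{\partial\ell}{\partial A}=\hat d_\eta x^{*T}+\eta^*\hat d_x^T,\qquad \frac{\partial\ell}{\partial b}=-\hat d_\eta .$$
   Context: Consider the quadratic program: minimize $\tfrac12 z^TQz+z^Tp$ over $z\in\mathbb{R}^{d_z}$ subject to $Az=b$ and $l\le z\le u$ (componentwise). Here $Q\in\mathbb{R}^{d_z\times d_z}$ is symmetric positive definite, $p,l,u\in\mathbb{R}^{d_z}$ with $l\le u$, $A\in\mathbb{R}^{d_{eq}\times d_z}$, $b\in\mathbb{R}^{d_{eq}}$. $\rho>0$ is a fixed penalty parameter; $I_v$ (also written $I$ in $Q+\rho I$) is the $d_z\times d_z$ identity, $I_\eta$ the $d_{eq}\times d_{eq}$ identity, and $I$ in $I-\nabla_{\tilde v}F$ the identity of size $d_z+d_{eq}$. The matrix $\begin{bmatrix}Q+\rho I&A^T\\ A&0\end{bmatrix}$ is assumed nonsingular. $\Pi$ is the projection onto the box: $\Pi(x)_j=l_j$ if $x_j<l_j$, $x_j$ if $l_j\le x_j\le u_j$, $u_j$ if $x_j>u_j$. $D\Pi(x)$ is the diagonal $d_z\times d_z$ matrix whose $j$-th diagonal entry is $1$ if $l_j\le x_j\le u_j$ and $0$ otherwise. The ADMM fixed-point map $F:\mathbb{R}^{d_z}\times\mathbb{R}^{d_{eq}}\to\mathbb{R}^{d_z}\times\mathbb{R}^{d_{eq}}$ is $$F(v,\eta)=-\begin{bmatrix}Q+\rho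 I & A^T\\ A&0\end{bmatrix}^{-1}\begin{bmatrix}p-\rho(2\Pi(v)-v)\\ -b\end{bmatrix}+\begin{bmatrix}v\\ \eta\end{bmatrix}-\begin{bmatrix}\Pi(v)\\ \eta\end{bmatrix},$$ with Jacobian in $\tilde v=(v,\eta)$ $$\nabla_{\tilde v}F=-\begin{bmatrix}Q+\rho I & A^T\\ A&0\end{bmatrix}^{-1}\begin{bmatrix}-\rho(2D\Pi(v)-I_v)&0\\0&0\end{bmatrix}+\begin{bmatrix}I_v&0\\0&I_\eta\end{bmatrix}-\begin{bmatrix}D\Pi(v)&0\\0&I_\eta\end{bmatrix}.$$ Gradient convention: the fixed point $\tilde v^*$, and hence $z^*=\Pi(v^* )$, is regarded as the locally defined differentiable implicit function of the problem variables (given by the implicit function theorem applied to $F(\tilde v)-\tilde v=0$), and $\ell$ as a function of the problem variables through $z^*$. The gradients are with respect to the Euclidean/Frobenius inner product: when $(Q,p,A,b)$ vary differentiably ($Q$ within symmetric matrices) with $l,u$ fixed, $d\ell=\langle\frac{\partial\ell}{\partial Q},dQ\rangle+\langle\frac{\partial\ell}{\partial p},dp\rangle+\langle\frac{\partial\ell}{\partial A},dA\rangle+\langle\frac{\partial\ell}{\partial b},db\rangle$. $B^{-T}$ denotes $(B^{-1})^T$. *)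

theory Defs
  imports "HOL-Analysis.Analysis"
begin

text \<open>Vectors of \<open>\<real>\<^sup>n \<times> \<real>\<^sup>m\<close> are stacked into vectors indexed by the sum type \<open>'n + 'm\<close>,
  so that block matrices are ordinary matrices over that index type.\<close>

definition stack :: "real ^ 'n \<Rightarrow> real ^ 'm \<Rightarrow> real ^ ('n + 'm)" where
  "stack x y = (\<chi> i. case i of Inl a \<Rightarrow> x $ a | Inr b \<Rightarrow> y $ b)"

definition upper :: "real ^ ('n + 'm::finite) \<Rightarrow> real ^ 'n" where
  "upper w = (\<chi> i. w $ Inl i)"

definition lower :: "real ^ ('n::finite + 'm) \<Rightarrow> real ^ 'm" where
  "lower w = (\<chi> i. w $ Inr i)"

definition block ::
  "real ^ 'n ^ 'p \<Rightarrow> real ^ 'm ^ 'p \<Rightarrow> real ^ 'n ^ 'q \<Rightarrow> real ^ 'm ^ 'q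
    \<Rightarrow> real ^ ('n + 'm) ^ ('p + 'q)" where
  "block A B C D =
     (\<chi> i j. case i of
        Inl r \<Rightarrow> (case j of Inl c \<Rightarrow> A $ r $ c | Inr c \<Rightarrow> B $ r $ c)
      | Inr r \<Rightarrow> (case j of Inl c \<Rightarrow> C $ r $ c | Inr c \<Rightarrow> D $ r $ c))"

definition outer :: "real ^ 'm \<Rightarrow> real ^ 'n \<Rightarrow> real ^ 'n ^ 'm" where
  "outer x y = (\<chi> i j. x $ i * y $ j)"

definition symmetric_pos_def :: "real ^ 'n ^ 'n \<Rightarrow> bool" where
  "symmetric_pos_def Q \<longleftrightarrow> transpose Q = Q \<and> (\<forall>x. x \<noteq> 0 \<longrightarrow> x \<bullet> (Q *v x) > 0)"

definition box_proj :: "real ^ 'n \<Rightarrow> real ^ 'n \<Rightarrow> real ^ 'n \<Rightarrow> real ^ 'n" where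
  "box_proj l u x =
     (\<chi> j. if x $ j < l $ j then l $ j else if x $ j \<le> u $ j then x $ j else u $ j)"

definition box_proj_deriv :: "real ^ 'n \<Rightarrow> real ^ 'n \<Rightarrow> real ^ 'n \<Rightarrow> real ^ 'n ^ 'n" where
  "box_proj_deriv l u x =
     (\<chi> i j. if i = j \<and> l $ i \<le> x $ i \<and> x $ i \<le> u $ i then 1 else 0)"

text \<open>The problem variables \<open>(Q, p, A, b)\<close>; the bounds \<open>l\<close>, \<open>u\<close> and the penalty \<open>\<rho>\<close> are constants.
  The inner product of this product space is the Euclidean/Frobenius one.\<close>

type_synonym ('n, 'm) qp_data =
  "(real ^ 'n ^ 'n) \<times> (real ^ 'n) \<times> (real ^ 'n ^ 'm) \<times> (real ^ 'm)"

definition qp_space :: "('n::finite, 'm::finite) qp_data set" where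
  "qp_space = {(Q, p, A, b). transpose Q = Q}"

definition kkt :: "real \<Rightarrow> real ^ 'n ^ 'n \<Rightarrow> real ^ 'n ^ 'm \<Rightarrow> real ^ ('n + 'm) ^ ('n + 'm)" where
  "kkt \<rho> Q A = block (Q + \<rho> *\<^sub>R mat 1) (transpose A) A 0"

definition admm_map ::
  "real \<Rightarrow> real ^ 'n \<Rightarrow> real ^ 'n \<Rightarrow> ('n, 'm::finite) qp_data \<Rightarrow> real ^ ('n + 'm) \<Rightarrow> real ^ ('n + 'm)" where
  "admm_map \<rho> l u \<theta> w =
     (case \<theta> of (Q, p, A, b) \<Rightarrow>
        - (matrix_inv (kkt \<rho> Q A) *v
             stack (p - \<rho> *\<^sub>R (2 *\<^sub>R box_proj l u (upper w) - upper w)) (- b))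
        + stack (upper w) (lower w) - stack (box_proj l u (upper w)) (lower w))"

definition admm_jacobian ::
  "real \<Rightarrow> real ^ 'n \<Rightarrow> real ^ 'n \<Rightarrow> ('n, 'm::finite) qp_data \<Rightarrow> real ^ ('n + 'm)
     \<Rightarrow> real ^ ('n + 'm) ^ ('n + 'm)" where
  "admm_jacobian \<rho> l u \<theta> w =
     (case \<theta> of (Q, p, A, b) \<Rightarrow>
        - (matrix_inv (kkt \<rho> Q A) **
             block (- (\<rho> *\<^sub>R (2 *\<^sub>R box_proj_deriv l u (upper w) - mat 1))) 0 0 0)
        + block (mat 1) 0 0 (mat 1) - block (box_proj_deriv l u (upper w)) 0 0 (mat 1))"

text \<open>\<open>V\<close>, considered on the neighbourhood \<open>U\<close> of \<open>\<theta>0\<close>, is a differentiable function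
  implicitly defined by \<open>F(V(\<theta>)) - V(\<theta>) = 0\<close> and passing through \<open>w\<close> at \<open>\<theta>0\<close>.\<close>

definition implicit_fixed_point ::
  "real \<Rightarrow> real ^ 'n \<Rightarrow> real ^ 'n \<Rightarrow> ('n, 'm::finite) qp_data \<Rightarrow> real ^ ('n + 'm)
     \<Rightarrow> ('n, 'm) qp_data set \<Rightarrow> (('n, 'm) qp_data \<Rightarrow> real ^ ('n + 'm)) \<Rightarrow> bool" where
  "implicit_fixed_point \<rho> l u \<theta>0 w U V \<longleftrightarrow>
     open U \<and> \<theta>0 \<in> U \<and> V \<theta>0 = w \<and> V differentiable_on (U \<inter> qp_space) \<and>
     (\<forall>\<theta> \<in> U \<inter> qp_space. admm_map \<rho> l u \<theta> (V \<theta>) - V \<theta> = 0)"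

text \<open>Since \<open>Q\<close> varies within the symmetric matrices only, the derivative is taken within
  \<^term>\<open>qp_space\<close>, and requiring the \<open>Q\<close>-gradient to be symmetric makes the gradients unique.\<close>

definition has_qp_gradients ::
  "(('n, 'm::finite) qp_data \<Rightarrow> real) \<Rightarrow> ('n, 'm) qp_data \<Rightarrow> real ^ 'n ^ 'n \<Rightarrow> real ^ 'n
     \<Rightarrow> real ^ 'n ^ 'm \<Rightarrow> real ^ 'm \<Rightarrow> bool" where
  "has_qp_gradients f \<theta> GQ Gp GA Gb \<longleftrightarrow>
     transpose GQ = GQ \<and>
     (f has_derivative (\<lambda>(dQ, dp, dA, db). GQ \<bullet> dQ + Gp \<bullet> dp + GA \<bullet> dA + Gb \<bullet> db))
       (at \<theta> within qp_space)"

end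

theory Submission
  imports Defs
begin

text \<open>Write \<open>D\<close> for the derivative of the box projection at \<open>v\<close>, \<open>E = diag(D, I)\<close>, \<open>K\<close> for the KKT
  matrix and \<open>R\<close> for the block matrix with upper left corner \<open>- \<rho> (2 D - I)\<close> and zeros elsewhere.

  Since no coordinate of \<open>v\<close> sits on a bound, the box projection is affine near \<open>v\<close>: the free
  coordinates are copied and the clipped ones stay constant
  (\<open>box_proj_locally_affine\<close>). Multiplied by \<open>K\<close>, the fixed-point equation is therefore, near
  \<open>(v, \<eta>)\<close>, a linear system \<open>M(\<theta>) w + k(\<theta>) = 0\<close> with \<open>M = K E + R\<close>
  (\<open>fixed_point_iff_residual_eq_0\<close>). Moreover \<open>I - \<nabla>F = K\<inverse> M\<close> (\<open>id_minus_admm_jacobian\<close>), so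
  that \<open>M\<close> is invertible at the base point and hence near it. Thus the implicit function exists,
  is unique near the fixed point, and is explicitly \<open>- M(\<theta>)\<inverse> k(\<theta>)\<close>, which is differentiable by
  Cramer's rule (\<open>admm_fixed_point_locally_solvable\<close>).

  As \<open>Q\<close> is symmetric, \<open>M\<^sup>T = E K + R\<close> is the matrix in the second formula for the adjoint
  vector \<open>(d\<^sub>x, d\<^sub>\<eta>)\<close>, and \<open>K\<inverse> (I - \<nabla>F)\<^sup>-\<^sup>T = K\<inverse> K M\<^sup>-\<^sup>T = M\<^sup>-\<^sup>T\<close> identifies the two formulas.

  Differentiating the linear system gives \<open>M dw = - (dQ x + dA\<^sup>T \<eta> + dp, dA x - db)\<close>
  (\<open>residual_has_derivative\<close>). The differential of the loss, \<open>grad_loss x \<bullet> D dv\<close>, is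
  \<open>- E (- grad_loss x, 0) \<bullet> dw = - M\<^sup>T (d\<^sub>x, d\<^sub>\<eta>) \<bullet> dw = - (d\<^sub>x, d\<^sub>\<eta>) \<bullet> M dw\<close>, that is,
  \<open>d\<^sub>x \<bullet> (dQ x + dA\<^sup>T \<eta> + dp) + d\<^sub>\<eta> \<bullet> (dA x - db)\<close> (\<open>adjoint_state_identity\<close>), and the
  gradients are read off as coefficients of this form (\<open>gradients_inner\<close>). There the
  symmetry of \<open>dQ\<close> allows the coefficient \<open>d\<^sub>x x\<^sup>T\<close> to be replaced by its symmetric part.\<close>

section \<open>Block vectors and block matrices\<close>

lemma upper_stack [simp]: "upper (stack x y) = x"
  by (simp add: upper_def stack_def vec_eq_iff)

lemma lower_stack [simp]: "lower (stack x y) = y"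
  by (simp add: lower_def stack_def vec_eq_iff)

lemma stack_upper_lower [simp]: "stack (upper w) (lower w) = w"
  by (auto simp: upper_def lower_def stack_def vec_eq_iff split: sum.split)

lemma stack_eq_iff: "stack x y = stack x' y' \<longleftrightarrow> x = x' \<and> y = y'"
  by (metis upper_stack lower_stack)

lemma stack_add: "stack x y + stack x' y' = stack (x + x') (y + y')"
  by (auto simp: stack_def vec_eq_iff split: sum.split)

lemma stack_scaleR: "c *\<^sub>R stack x y = stack (c *\<^sub>R x) (c *\<^sub>R y)"
  by (auto simp: stack_def vec_eq_iff split: sum.split)

lemma sum_UNIV_sum_type:
  fixes f :: "'a::finite + 'b::finite \<Rightarrow> 'c::comm_monoid_add"
  shows "(\<Sum>i\<in>UNIV. f i) = (\<Sum>i\<in>UNIV. f (Inl i)) + (\<Sum>i\<in>UNIV. f (Inr i))"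
  by (subst UNIV_Plus_UNIV [symmetric], subst sum.Plus) (auto simp: o_def)

lemma inner_stack: "stack x y \<bullet> stack x' y' = x \<bullet> x' + y \<bullet> y'"
  by (simp add: inner_vec_def sum_UNIV_sum_type stack_def)

lemma block_mult_stack:
  "block A B C D *v stack x y = stack (A *v x + B *v y) (C *v x + D *v y)"
  by (auto simp: block_def stack_def vec_eq_iff matrix_vector_mult_def sum_UNIV_sum_type
      split: sum.split)

lemma transpose_block:
  "transpose (block A B C D) = block (transpose A) (transpose C) (transpose B) (transpose D)"
  by (auto simp: block_def transpose_def vec_eq_iff split: sum.split)

lemma block_add:
  "block A B C D + block A' B' C' D' = block (A + A') (B + B') (C + C') (D + D')"
  by (auto simp: block_def vec_eq_iff split: sum.split)

lemma block_mat_1: "block (mat 1) 0 0 (mat 1) = mat 1"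
  by (auto simp: block_def mat_def vec_eq_iff split: sum.split)

lemma bounded_linear_upper: "bounded_linear upper"
  by (rule linear_conv_bounded_linear [THEN iffD1], rule linearI)
     (auto simp: upper_def vec_eq_iff)

lemma bounded_linear_stack_pair: "bounded_linear (\<lambda>z. stack (fst z) (snd z))"
  by (rule linear_conv_bounded_linear [THEN iffD1], rule linearI)
     (auto simp: stack_add stack_scaleR)

section \<open>Inverse matrices and adjoints\<close>

lemma matrix_inv:
  assumes "invertible M"
  shows matrix_inv_right: "M ** matrix_inv M = mat 1"
    and matrix_inv_left: "matrix_inv M ** M = mat 1"
  using someI_ex [OF assms [unfolded invertible_def]] by (auto simp: matrix_inv_def)

lemma matrix_inv_unique:
  fixes M :: "real ^ 'n ^ 'n"
  assumes "M ** B = mat 1"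
  shows "matrix_inv M = B"
proof -
  have "invertible M" using assms invertible_right_inverse by blast
  then show ?thesis
    by (metis assms matrix_inv_left matrix_mul_assoc matrix_mul_lid matrix_mul_rid)
qed

lemma matrix_inv_mult_eq_iff:
  fixes M :: "real ^ 'n ^ 'n"
  assumes "invertible M"
  shows "matrix_inv M *v y = w \<longleftrightarrow> M *v w = y"
  by (metis assms matrix_inv_left matrix_inv_right matrix_vector_mul_assoc matrix_vector_mul_lid)

lemma inner_outer: "outer a b \<bullet> M = a \<bullet> (M *v b)"
  by (simp add: inner_vec_def outer_def matrix_vector_mult_def sum_distrib_left mult_ac)

lemma inner_matrix_vector_transpose:
  fixes M :: "real ^ 'n ^ 'm"
  shows "x \<bullet> (M *v y) = (transpose M *v x) \<bullet> y"
  by (simp add: dot_lmul_matrix)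

section \<open>Differentiability of the solution of a linear system\<close>

lemma bounded_bilinear_matrix_vector_mult:
  "bounded_bilinear ((*v) :: real ^ 'n ^ 'm \<Rightarrow> real ^ 'n \<Rightarrow> real ^ 'm)"
  by (rule bilinear_conv_bounded_bilinear [THEN iffD1])
     (auto simp: bilinear_def matrix_vector_mult_def vec_eq_iff algebra_simps sum.distrib
       sum_distrib_left intro!: linearI)

lemma differentiable_vec_nth:
  fixes f :: "'a::real_normed_vector \<Rightarrow> 'b::real_normed_vector ^ 'n"
  assumes "f differentiable F"
  shows "(\<lambda>t. f t $ i) differentiable F"
proof -
  obtain f' where "(f has_derivative f') F"
    using assms unfolding differentiable_def by blast
  then have "((\<lambda>t. f t $ i) has_derivative (\<lambda>h. f' h $ i)) F"
    by (rule bounded_linear.has_derivative [OF bounded_linear_vec_nth])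
  then show ?thesis unfolding differentiable_def by blast
qed

lemma differentiable_vec_lambda:
  fixes f :: "'a::real_normed_vector \<Rightarrow> real ^ 'n"
  assumes "\<And>i. (\<lambda>t. f t $ i) differentiable (at t0 within S)"
  shows "f differentiable (at t0 within S)"
  unfolding differentiable_componentwise_within [of f]
proof
  fix e :: "real ^ 'n" assume "e \<in> Basis"
  then obtain i where "e = axis i 1" by (auto simp: Basis_vec_def)
  then show "(\<lambda>t. f t \<bullet> e) differentiable (at t0 within S)"
    using assms [of i] by (simp add: inner_axis)
qed

lemma differentiable_prod:
  fixes f :: "'i \<Rightarrow> 'a::real_normed_vector \<Rightarrow> real"
  assumes "\<And>i. i \<in> I \<Longrightarrow> f i differentiable (at t0 within S)"
  shows "(\<lambda>t. \<Prod>i\<in>I. f i t) differentiable (at t0 within S)"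
proof -
  obtain f' where "\<And>i. i \<in> I \<Longrightarrow> (f i has_derivative f' i) (at t0 within S)"
    using assms unfolding differentiable_def by metis
  then show ?thesis
    by (intro differentiableI [OF has_derivative_prod])
qed

lemma differentiable_det:
  fixes M :: "'a::real_normed_vector \<Rightarrow> real ^ 'n ^ 'n"
  assumes "\<And>i j. (\<lambda>t. M t $ i $ j) differentiable (at t0 within S)"
  shows "(\<lambda>t. det (M t)) differentiable (at t0 within S)"
  unfolding det_def
proof (rule differentiable_sum)
  show "finite {p. p permutes (UNIV :: 'n set)}" by (simp add: finite_permutations)
qed (intro ballI differentiable_mult differentiable_const differentiable_prod assms)

text \<open>By Cramer's rule the solution is a quotient of determinants of matrices whose entries depend
  differentiably on the parameter.\<close>

lemma differentiable_linear_solution: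
  fixes M :: "'a::real_normed_vector \<Rightarrow> real ^ 'n ^ 'n"
  assumes M: "\<And>t. M differentiable (at t)" and k: "k differentiable (at t0)"
    and inv: "invertible (M t0)"
  shows "(\<lambda>t. matrix_inv (M t) *v k t) differentiable (at t0)"
proof -
  have Mij: "(\<lambda>t. M t $ i $ j) differentiable (at t)" for i j t
    by (rule differentiable_vec_nth, rule differentiable_vec_nth, rule M)
  define S where "S = {t. det (M t) \<noteq> 0}"
  have "(\<lambda>t. det (M t)) differentiable_on UNIV"
    unfolding differentiable_on_def by (intro ballI differentiable_det Mij)
  then have "continuous_on UNIV (\<lambda>t. det (M t))"
    by (rule differentiable_imp_continuous_on)
  then have "open S"
    unfolding S_def by (intro open_Collect_neq continuous_on_const)
  have t0: "t0 \<in> S" using inv by (simp add: S_def invertible_det_nz)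
  define N where "N j t = (\<chi> i i'. if i' = j then k t $ i else M t $ i $ i')" for j t
  define c where "c t = (\<chi> j. det (N j t) / det (M t))" for t
  have "c differentiable (at t0)"
  proof (rule differentiable_vec_lambda)
    fix j
    have "(\<lambda>t. N j t $ i $ i') differentiable (at t0)" for i i'
      by (cases "i' = j") (simp_all add: N_def Mij differentiable_vec_nth k)
    then have "(\<lambda>t. det (N j t) / det (M t)) differentiable (at t0)"
      using t0 by (intro differentiable_divide differentiable_det Mij) (simp_all add: S_def)
    then show "(\<lambda>t. c t $ j) differentiable (at t0)" by (simp add: c_def)
  qed
  then obtain c' where c': "(c has_derivative c') (at t0)"
    unfolding differentiable_def by blast
  have "c t = matrix_inv (M t) *v k t" if "t \<in> S" for t
  proof -
    have d: "det (M t) \<noteq> 0" using that by (simp add: S_def)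
    have "M t *v c t = k t"
      unfolding c_def N_def by (rule cramer [OF d, THEN iffD2, OF refl])
    moreover have "invertible (M t)" using d by (simp only: invertible_det_nz not_False_eq_True)
    ultimately show ?thesis
      by (rule matrix_inv_mult_eq_iff [THEN iffD2, symmetric, rotated])
  qed
  then have "((\<lambda>t. matrix_inv (M t) *v k t) has_derivative c') (at t0)"
    by (rule has_derivative_transform_within_open [OF c' \<open>open S\<close> t0])
  then show ?thesis by (rule differentiableI)
qed

text \<open>Difference quotients within a subspace only see displacements in that subspace. This lets a
  derivative be replaced by one that agrees with it on the subspace alone, as is needed for
  gradients with respect to symmetric matrices.\<close>

lemma has_derivative_within_subspace_cong:
  assumes f: "(f has_derivative f') (at t0 within S)" and "subspace S" "t0 \<in> S"
    and g': "bounded_linear g'" and eq: "\<And>h. h \<in> S \<Longrightarrow> f' h = g' h"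
  shows "(f has_derivative g') (at t0 within S)"
proof -
  have eq': "f' (t - t0) = g' (t - t0)" if "t \<in> S" for t
    by (rule eq, rule subspace_diff) (rule assms that)+
  have "((\<lambda>y. (1 / norm (y - t0)) *\<^sub>R (f y - (f t0 + g' (y - t0)))) \<longlongrightarrow> 0) (at t0 within S)"
  proof (rule Lim_transform_within [OF _ zero_less_one])
    show "((\<lambda>y. (1 / norm (y - t0)) *\<^sub>R (f y - (f t0 + f' (y - t0)))) \<longlongrightarrow> 0) (at t0 within S)"
      using f unfolding has_derivative_within by blast
  qed (simp add: eq')
  with g' show ?thesis unfolding has_derivative_within by blast
qed

section \<open>The box projection away from the bounds\<close>

lemma box_proj_deriv_mult:
  "(box_proj_deriv l u v *v y) $ j = (if l $ j \<le> v $ j \<and> v $ j \<le> u $ j then y $ j else 0)"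
  by (auto simp: box_proj_deriv_def matrix_vector_mult_def
      if_distrib [of "\<lambda>t. t * _"] cong: if_cong)

lemma transpose_box_proj_deriv: "transpose (box_proj_deriv l u v) = box_proj_deriv l u v"
  by (auto simp: box_proj_deriv_def transpose_def vec_eq_iff)

text \<open>Each coordinate of a point near \<open>v\<close> lies strictly on the same side of each bound as the
  coordinate of \<open>v\<close>, so the projection acts on it by the same branch.\<close>

lemma box_proj_locally_affine:
  assumes "\<forall>j. v $ j \<notin> {l $ j, u $ j}"
  shows "eventually (\<lambda>y. box_proj l u y = box_proj l u v + box_proj_deriv l u v *v (y - v)) (nhds v)"
proof -
  have "\<forall>\<^sub>F y in nhds v. box_proj l u y $ j
          = box_proj l u v $ j + (box_proj_deriv l u v *v (y - v)) $ j" for j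
  proof -
    have lim: "((\<lambda>y. y $ j) \<longlongrightarrow> v $ j) (nhds v)"
      by (intro tendsto_vec_nth filterlim_ident)
    consider "v $ j < l $ j" | "l $ j < v $ j" "v $ j < u $ j" | "l $ j < v $ j" "u $ j < v $ j"
      using assms by force
    then show ?thesis
    proof cases
      case 1
      show ?thesis using order_tendstoD(2) [OF lim 1]
        by eventually_elim (use 1 in \<open>simp add: box_proj_def box_proj_deriv_mult\<close>)
    next
      case 2
      show ?thesis using order_tendstoD(1) [OF lim 2(1)] order_tendstoD(2) [OF lim 2(2)]
        by eventually_elim (use 2 in \<open>simp add: box_proj_def box_proj_deriv_mult\<close>)
    next
      case 3
      show ?thesis using order_tendstoD(1) [OF lim 3(1)] order_tendstoD(1) [OF lim 3(2)]
        by eventually_elim (use 3 in \<open>simp add: box_proj_def box_proj_deriv_mult\<close>)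
    qed
  qed
  then show ?thesis by (simp add: vec_eq_iff eventually_all_finite)
qed

section \<open>The fixed-point equation as a linear system\<close>

lemma admm_map_eq_iff:
  assumes "invertible (kkt \<rho> Q A)"
  shows "admm_map \<rho> l u (Q, p, A, b) w = w \<longleftrightarrow>
    kkt \<rho> Q A *v stack (box_proj l u (upper w)) (lower w)
      + stack (p - \<rho> *\<^sub>R (2 *\<^sub>R box_proj l u (upper w) - upper w)) (- b) = 0"
    (is "_ \<longleftrightarrow> _ *v ?s + ?r = 0")
proof -
  have "admm_map \<rho> l u (Q, p, A, b) w = - (matrix_inv (kkt \<rho> Q A) *v ?r) + w - ?s"
    by (simp add: admm_map_def)
  also have "\<dots> = w \<longleftrightarrow> matrix_inv (kkt \<rho> Q A) *v ?r = - ?s"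
    (is "- ?z + w - _ = w \<longleftrightarrow> _")
  proof -
    have "- ?z + w - ?s - w = - (?z + ?s)" by simp
    then show ?thesis by (metis eq_iff_diff_eq_0 eq_neg_iff_add_eq_0 neg_equal_0_iff_equal)
  qed
  also have "\<dots> \<longleftrightarrow> kkt \<rho> Q A *v (- ?s) = ?r"
    by (rule matrix_inv_mult_eq_iff [OF assms])
  also have "kkt \<rho> Q A *v (- ?s) = - (kkt \<rho> Q A *v ?s)"
    by (rule linear_neg [OF matrix_vector_mul_linear])
  also have "\<dots> = ?r \<longleftrightarrow> kkt \<rho> Q A *v ?s + ?r = 0"
    by (rule neg_eq_iff_add_eq_0)
  finally show ?thesis .
qed

text \<open>The coefficient matrix \<open>K E + R\<close> of the linear system into which the fixed-point equation turns
  when the box projection is replaced by an affine map with linear part \<open>D\<close>.\<close>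

definition residual_matrix ::
  "real \<Rightarrow> real ^ 'n ^ 'n \<Rightarrow> real ^ 'n ^ 'n \<Rightarrow> real ^ 'n ^ 'm \<Rightarrow> real ^ ('n + 'm) ^ ('n + 'm)" where
  "residual_matrix \<rho> D Q A =
     kkt \<rho> Q A ** block D 0 0 (mat 1) + block (- (\<rho> *\<^sub>R (2 *\<^sub>R D - mat 1))) 0 0 0"

lemma residual_matrix_mult:
  "residual_matrix \<rho> D Q A *v w =
     kkt \<rho> Q A *v stack (D *v upper w) (lower w)
       + stack (\<rho> *\<^sub>R upper w - (2 * \<rho>) *\<^sub>R (D *v upper w)) 0"
proof -
  have "residual_matrix \<rho> D Q A *v stack (upper w) (lower w) =
     kkt \<rho> Q A *v stack (D *v upper w) (lower w)
       + stack (\<rho> *\<^sub>R upper w - (2 * \<rho>) *\<^sub>R (D *v upper w)) 0"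
    unfolding residual_matrix_def matrix_vector_mult_add_rdistrib
      matrix_vector_mul_assoc [symmetric] block_mult_stack
    by (simp add: matrix_vector_mult_diff_rdistrib scaleR_matrix_vector_assoc [symmetric]
        scaleR_diff_right mult.commute [of 2])
  then show ?thesis by simp
qed

lemma id_minus_admm_jacobian:
  assumes "invertible (kkt \<rho> Q A)"
  shows "mat 1 - admm_jacobian \<rho> l u (Q, p, A, b) w =
    matrix_inv (kkt \<rho> Q A) ** residual_matrix \<rho> (box_proj_deriv l u (upper w)) Q A"
  by (simp add: admm_jacobian_def residual_matrix_def matrix_add_ldistrib matrix_mul_assoc
      matrix_inv_left [OF assms] block_mat_1)

lemma transpose_residual_matrix:
  assumes "transpose Q = Q" "transpose D = D"
  shows "transpose (residual_matrix \<rho> D Q A) =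
    block D 0 0 (mat 1) ** kkt \<rho> Q A + block (- (\<rho> *\<^sub>R (2 *\<^sub>R D - mat 1))) 0 0 0"
proof -
  have tadd: "transpose (X + Y) = transpose X + transpose Y" for X Y :: "real ^ 'x ^ 'y"
    by (simp add: transpose_def vec_eq_iff)
  have tscale: "transpose (c *\<^sub>R X) = c *\<^sub>R transpose X" for c and X :: "real ^ 'x ^ 'y"
    by (simp add: transpose_def vec_eq_iff)
  have t0: "transpose (0 :: real ^ 'x ^ 'y) = 0"
    by (simp add: transpose_def vec_eq_iff)
  have "transpose (- (\<rho> *\<^sub>R (2 *\<^sub>R D - mat 1))) = - (\<rho> *\<^sub>R (2 *\<^sub>R D - mat 1))"
    using assms(2) by (simp add: transpose_def vec_eq_iff mat_def)
  then show ?thesis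
    by (simp add: residual_matrix_def tadd matrix_transpose_mul transpose_block kkt_def t0
        assms tscale)
qed

text \<open>The KKT matrix is affine in the problem data; its linear part is the KKT matrix for the penalty
  parameter 0, which therefore serves as its derivative.\<close>

lemma kkt_split: "kkt \<rho> Q A = kkt 0 Q A + block (\<rho> *\<^sub>R mat 1) 0 0 0"
  by (simp add: kkt_def block_add)

lemma bounded_linear_kkt_0:
  "bounded_linear (\<lambda>\<theta> :: ('n::finite, 'm::finite) qp_data. kkt 0 (fst \<theta>) (fst (snd (snd \<theta>))))"
  by (rule linear_conv_bounded_linear [THEN iffD1], rule linearI)
     (auto simp: kkt_def block_def transpose_def vec_eq_iff split: sum.split)

lemma kkt_has_derivative:
  "((\<lambda>\<theta> :: ('n::finite, 'm::finite) qp_data. kkt \<rho> (fst \<theta>) (fst (snd (snd \<theta>))))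
     has_derivative (\<lambda>h. kkt 0 (fst h) (fst (snd (snd h))))) (at \<theta>0)"
  unfolding kkt_split [of \<rho>]
  using has_derivative_add [OF bounded_linear_imp_has_derivative [OF bounded_linear_kkt_0]
      has_derivative_const] by simp

text \<open>The constant term of the same linear system, where \<open>c\<close> is the constant part of the affine map
  that replaces the box projection.\<close>

definition residual_offset ::
  "real \<Rightarrow> real ^ 'n \<Rightarrow> ('n, 'm::finite) qp_data \<Rightarrow> real ^ ('n + 'm)" where
  "residual_offset \<rho> c \<theta> = (case \<theta> of (Q, p, A, b) \<Rightarrow>
     kkt \<rho> Q A *v stack c 0 + stack (p - (2 * \<rho>) *\<^sub>R c) (- b))"

lemma fixed_point_iff_residual_eq_0:
  assumes "invertible (kkt \<rho> Q A)" and "box_proj l u (upper w) = c + D *v upper w"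
  shows "admm_map \<rho> l u (Q, p, A, b) w = w \<longleftrightarrow>
    residual_matrix \<rho> D Q A *v w + residual_offset \<rho> c (Q, p, A, b) = 0"
proof -
  let ?y = "D *v upper w"
  have "kkt \<rho> Q A *v stack (c + ?y) (lower w)
      = kkt \<rho> Q A *v stack ?y (lower w) + kkt \<rho> Q A *v stack c 0"
    by (simp add: matrix_vector_right_distrib [symmetric] stack_add add.commute)
  moreover have "stack (p - \<rho> *\<^sub>R (2 *\<^sub>R (c + ?y) - upper w)) (- b)
      = stack (\<rho> *\<^sub>R upper w - (2 * \<rho>) *\<^sub>R ?y) 0 + stack (p - (2 * \<rho>) *\<^sub>R c) (- b)"
    by (simp add: stack_add stack_eq_iff algebra_simps)
  ultimately show ?thesis
    unfolding admm_map_eq_iff [OF assms(1)] residual_matrix_mult residual_offset_def assms(2)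
    by (simp add: add_ac)
qed

lemma residual_matrix_differentiable:
  "(\<lambda>\<theta> :: ('n::finite, 'm::finite) qp_data. residual_matrix \<rho> D (fst \<theta>) (fst (snd (snd \<theta>))))
     differentiable (at \<theta>0)"
proof -
  have "bounded_linear (\<lambda>X :: real ^ ('n + 'm) ^ ('n + 'm). X ** block D 0 0 (mat 1))"
    by (rule linear_conv_bounded_linear [THEN iffD1], rule linearI)
       (simp_all add: matrix_matrix_mult_def vec_eq_iff algebra_simps sum.distrib sum_distrib_left)
  from bounded_linear.has_derivative [OF this kkt_has_derivative]
  show ?thesis
    unfolding residual_matrix_def
    by (intro differentiable_add differentiable_const) (rule differentiableI)
qed

text \<open>The terms containing the derivative of \<open>K\<close> recombine: \<open>K\<close> enters the residual as the factor of
  \<open>E V + (c, 0)\<close>, and when \<open>c + D v\<close> is the projected point \<open>x\<close> this is the vector \<open>(x, \<eta>)\<close>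
  that multiplies \<open>dQ\<close> and \<open>dA\<close> in the gradients.\<close>

lemma residual_has_derivative:
  fixes V :: "('n::finite, 'm::finite) qp_data \<Rightarrow> real ^ ('n + 'm)"
  assumes V: "(V has_derivative V') (at (Q, p, A, b))"
  shows "((\<lambda>\<theta>. residual_matrix \<rho> D (fst \<theta>) (fst (snd (snd \<theta>))) *v V \<theta> + residual_offset \<rho> c \<theta>)
     has_derivative
       (\<lambda>h. residual_matrix \<rho> D Q A *v V' h
          + kkt 0 (fst h) (fst (snd (snd h)))
              *v stack (c + D *v upper (V (Q, p, A, b))) (lower (V (Q, p, A, b)))
          + stack (fst (snd h)) (- snd (snd (snd h))))) (at (Q, p, A, b))"
proof -
  let ?E = "block D 0 0 (mat 1) :: real ^ ('n + 'm) ^ ('n + 'm)"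
  let ?R = "block (- (\<rho> *\<^sub>R (2 *\<^sub>R D - mat 1))) 0 0 0 :: real ^ ('n + 'm) ^ ('n + 'm)"
  let ?K = "\<lambda>\<theta> :: ('n, 'm) qp_data. kkt \<rho> (fst \<theta>) (fst (snd (snd \<theta>)))"
  let ?K' = "\<lambda>\<theta> :: ('n, 'm) qp_data. kkt 0 (fst \<theta>) (fst (snd (snd \<theta>)))"
  have E: "?E *v w = stack (D *v upper w) (lower w)" for w
    using block_mult_stack [of D 0 0 "mat 1" "upper w" "lower w"] by simp
  have mv: "((\<lambda>\<theta>. X *v f \<theta>) has_derivative (\<lambda>h. X *v f' h)) F"
    if "(f has_derivative f') F" for X :: "real ^ ('n + 'm) ^ ('n + 'm)" and f f' and F :: "('n, 'm) qp_data filter"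
    by (rule bounded_linear.has_derivative [OF matrix_vector_mul_bounded_linear that])
  have s: "((\<lambda>\<theta> :: ('n, 'm) qp_data. stack (fst (snd \<theta>) - (2 * \<rho>) *\<^sub>R c) (- snd (snd (snd \<theta>))))
      has_derivative (\<lambda>h. stack (fst (snd h)) (- snd (snd (snd h))))) (at (Q, p, A, b))"
  proof -
    have "((\<lambda>\<theta> :: ('n, 'm) qp_data. (fst (snd \<theta>) - (2 * \<rho>) *\<^sub>R c, - snd (snd (snd \<theta>))))
      has_derivative (\<lambda>h. (fst (snd h), - snd (snd (snd h))))) (at (Q, p, A, b))"
      by (auto intro!: derivative_eq_intros)
    from bounded_linear.has_derivative [OF bounded_linear_stack_pair this] show ?thesis by simp
  qed
  have eq: "stack (c + D *v upper w) (lower w) = ?E *v w + stack c 0" for w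
    by (simp add: E stack_add add.commute)
  have "((\<lambda>\<theta>. ?K \<theta> *v (?E *v V \<theta> + stack c 0) + ?R *v V \<theta>
            + stack (fst (snd \<theta>) - (2 * \<rho>) *\<^sub>R c) (- snd (snd (snd \<theta>))))
     has_derivative (\<lambda>h. (?K (Q, p, A, b) *v (?E *v V' h + 0)
          + ?K' h *v (?E *v V (Q, p, A, b) + stack c 0)) + ?R *v V' h
          + stack (fst (snd h)) (- snd (snd (snd h))))) (at (Q, p, A, b))"
    by (intro has_derivative_add s mv V has_derivative_const
        bounded_bilinear.FDERIV [OF bounded_bilinear_matrix_vector_mult kkt_has_derivative])
  then show ?thesis
    by (simp add: eq residual_matrix_def residual_offset_def case_prod_unfold
        matrix_vector_mult_add_rdistrib matrix_vector_right_distrib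
        matrix_vector_mul_assoc [symmetric] add_ac)
qed

text \<open>The offset is the residual of the constant function 0, so its differentiability is a special
  case of the previous lemma.\<close>

lemma residual_offset_differentiable:
  "residual_offset \<rho> c differentiable (at (Q, p, A, b))"
proof -
  have "((\<lambda>\<theta>. residual_matrix \<rho> 0 (fst \<theta>) (fst (snd (snd \<theta>))) *v 0 + residual_offset \<rho> c \<theta>)
     differentiable (at (Q, p, A, b)))"
    by (rule differentiableI, rule residual_has_derivative) (rule has_derivative_const)
  then show ?thesis by simp
qed

text \<open>This plays the part of the implicit function theorem. Near the fixed point the equation is
  equivalent to a linear system with invertible coefficient matrix, so that it can be solved
  explicitly; \<open>U\<close> is chosen so that the solution stays in the region \<open>W\<close> where the box projection
  is affine, and there it is the only fixed point.\<close>

lemma admm_fixed_point_locally_solvable: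
  fixes Q :: "real ^ 'n ^ 'n" and A :: "real ^ 'n ^ 'm"
  assumes K: "invertible (kkt \<rho> Q A)"
    and M: "invertible (residual_matrix \<rho> (box_proj_deriv l u v) Q A)"
    and fixed: "admm_map \<rho> l u (Q, p, A, b) (stack v \<eta>) = stack v \<eta>"
    and off: "\<forall>j. v $ j \<notin> {l $ j, u $ j}"
  defines "D \<equiv> box_proj_deriv l u v"
  defines "c \<equiv> box_proj l u v - D *v v"
  obtains U W V where "open U" "(Q, p, A, b) \<in> U" "open W" "stack v \<eta> \<in> W"
    and "V (Q, p, A, b) = stack v \<eta>"
    and "\<And>\<theta>. \<theta> \<in> U \<Longrightarrow> V differentiable (at \<theta>)"
    and "\<And>\<theta>. \<theta> \<in> U \<Longrightarrow> V \<theta> \<in> W"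
    and "\<And>\<theta> w. \<theta> \<in> U \<Longrightarrow> w \<in> W \<Longrightarrow> admm_map \<rho> l u \<theta> w = w \<longleftrightarrow> w = V \<theta>"
    and "\<And>w. w \<in> W \<Longrightarrow> box_proj l u (upper w) = c + D *v upper w"
    and "\<And>\<theta>. \<theta> \<in> U \<Longrightarrow>
           residual_matrix \<rho> D (fst \<theta>) (fst (snd (snd \<theta>))) *v V \<theta> + residual_offset \<rho> c \<theta> = 0"
proof -
  let ?\<theta> = "(Q, p, A, b)"
  let ?M = "\<lambda>\<theta> :: ('n, 'm) qp_data. residual_matrix \<rho> D (fst \<theta>) (fst (snd (snd \<theta>)))"
  let ?K = "\<lambda>\<theta> :: ('n, 'm) qp_data. kkt \<rho> (fst \<theta>) (fst (snd (snd \<theta>)))"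
  define V where "V \<theta> = matrix_inv (?M \<theta>) *v (- residual_offset \<rho> c \<theta>)" for \<theta>
  obtain N where N: "open N" "v \<in> N"
    "\<And>y. y \<in> N \<Longrightarrow> box_proj l u y = box_proj l u v + D *v (y - v)"
    using box_proj_locally_affine [OF off] unfolding eventually_nhds D_def by blast
  define W where "W = (upper -` N :: (real ^ ('n + 'm)) set)"
  have "open W" unfolding W_def
    by (intro open_vimage N(1) linear_continuous_on bounded_linear_upper)
  have affine: "box_proj l u (upper w) = c + D *v upper w" if "w \<in> W" for w
    using N(3) [of "upper w"] that
    by (simp add: W_def c_def matrix_vector_mult_diff_distrib)
  define U0 where "U0 = {\<theta>. det (?K \<theta>) \<noteq> 0} \<inter> {\<theta>. det (?M \<theta>) \<noteq> 0}"
  have det: "(\<lambda>\<theta>. det (X \<theta>)) differentiable (at \<theta>)"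
    if "\<And>\<theta>. X differentiable (at \<theta>)" for X :: "('n, 'm) qp_data \<Rightarrow> real ^ ('n + 'm) ^ ('n + 'm)" and \<theta>
    by (rule differentiable_det) (rule differentiable_vec_nth, rule differentiable_vec_nth, rule that)
  have cont: "continuous_on UNIV (\<lambda>\<theta>. det (X \<theta>))"
    if "\<And>\<theta>. X differentiable (at \<theta>)" for X :: "('n, 'm) qp_data \<Rightarrow> real ^ ('n + 'm) ^ ('n + 'm)"
    by (rule differentiable_imp_continuous_on, rule differentiable_at_imp_differentiable_on)
       (rule det, rule that)
  have "open U0" unfolding U0_def
    by (intro open_Int open_Collect_neq continuous_on_const cont residual_matrix_differentiable
        differentiableI [OF kkt_has_derivative])
  have invK: "invertible (?K \<theta>)" and invM: "invertible (?M \<theta>)" if "\<theta> \<in> U0" for \<theta>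
    using that by (simp_all add: U0_def invertible_det_nz)
  have "?\<theta> \<in> U0" using K M by (simp add: U0_def D_def invertible_det_nz)
  have solve: "w = V \<theta> \<longleftrightarrow> ?M \<theta> *v w + residual_offset \<rho> c \<theta> = 0" if "\<theta> \<in> U0" for \<theta> w
  proof -
    have "w = V \<theta> \<longleftrightarrow> ?M \<theta> *v w = - residual_offset \<rho> c \<theta>"
      unfolding V_def using matrix_inv_mult_eq_iff [OF invM [OF that]] by metis
    then show ?thesis by (simp add: eq_neg_iff_add_eq_0)
  qed
  have char: "admm_map \<rho> l u \<theta> w = w \<longleftrightarrow> w = V \<theta>" if "\<theta> \<in> U0" "w \<in> W" for \<theta> w
  proof -
    obtain Q1 p1 A1 b1 where \<theta>: "\<theta> = (Q1, p1, A1, b1)" by (cases \<theta>)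
    have "invertible (kkt \<rho> Q1 A1)" using invK [OF that(1)] by (simp add: \<theta>)
    from fixed_point_iff_residual_eq_0 [OF this affine [OF that(2)]]
    show ?thesis unfolding solve [OF that(1)] by (simp add: \<theta>)
  qed
  have "stack v \<eta> \<in> W" by (simp add: W_def N)
  then have V0: "V ?\<theta> = stack v \<eta>"
    using char \<open>?\<theta> \<in> U0\<close> fixed by metis
  have diff: "V differentiable (at \<theta>)" if "\<theta> \<in> U0" for \<theta>
  proof -
    have "residual_offset \<rho> c differentiable (at \<theta>)"
      by (cases \<theta>) (simp only: residual_offset_differentiable)
    then show ?thesis unfolding V_def
      by (intro differentiable_linear_solution residual_matrix_differentiable
          differentiable_minus invM that)
  qed
  define U where "U = U0 \<inter> V -` W"
  have "open U" unfolding U_def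
  proof (rule continuous_open_preimage [OF _ \<open>open U0\<close> \<open>open W\<close>])
    show "continuous_on U0 V"
      by (intro differentiable_imp_continuous_on differentiable_at_imp_differentiable_on diff)
  qed
  show ?thesis
  proof (rule that [of U W V])
    show "?\<theta> \<in> U" using \<open>?\<theta> \<in> U0\<close> \<open>stack v \<eta> \<in> W\<close> by (simp add: U_def V0)
    show "?M \<theta> *v V \<theta> + residual_offset \<rho> c \<theta> = 0" if "\<theta> \<in> U" for \<theta>
      using solve that unfolding U_def by blast
  qed (use \<open>open U\<close> \<open>open W\<close> \<open>stack v \<eta> \<in> W\<close> V0 diff char affine in \<open>auto simp: U_def\<close>)
qed

section \<open>Gradients by the adjoint state\<close>

text \<open>The point of the adjoint method: the sensitivity \<open>y\<close> enters the derivative of the loss only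
  through its product with a vector in the range of \<open>M\<^sup>T\<close>, so it can be eliminated by moving \<open>M\<close>
  to the other side, where \<open>M y\<close> is known.\<close>

lemma adjoint_state_identity:
  assumes s: "transpose M *v s = block D 0 0 (mat 1) *v stack (- g) 0"
    and y: "M *v y = - r" and D: "transpose D = D"
  shows "(D *v upper y) \<bullet> g = s \<bullet> r"
proof -
  have "s \<bullet> r = - (s \<bullet> (M *v y))" by (simp add: y)
  also have "\<dots> = - ((block D 0 0 (mat 1) *v stack (- g) 0) \<bullet> y)"
    by (simp only: inner_matrix_vector_transpose s)
  also have "\<dots> = (D *v g) \<bullet> upper y"
    using inner_stack [of "D *v (- g)" 0 "upper y" "lower y"]
    by (simp add: block_mult_stack linear_neg [OF matrix_vector_mul_linear])
  also have "\<dots> = g \<bullet> (D *v upper y)"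
    by (simp only: inner_matrix_vector_transpose D)
  finally show ?thesis by (simp add: inner_commute)
qed

text \<open>Reads the gradients off the derivative of the loss. Symmetry of \<open>dQ\<close> makes \<open>d\<^sub>x x\<^sup>T\<close> and
  \<open>x d\<^sub>x\<^sup>T\<close> have the same product with \<open>dQ\<close>, so their mean can be taken.\<close>

lemma gradients_inner:
  fixes dA :: "real ^ 'n ^ 'm"
  assumes "transpose dQ = dQ"
  shows "stack d\<^sub>x d\<^sub>\<eta> \<bullet> (kkt 0 dQ dA *v stack x \<eta> + stack dp (- db)) =
    ((1 / 2) *\<^sub>R (outer d\<^sub>x x + outer x d\<^sub>x)) \<bullet> dQ + d\<^sub>x \<bullet> dp
      + (outer d\<^sub>\<eta> x + outer \<eta> d\<^sub>x) \<bullet> dA + (- d\<^sub>\<eta>) \<bullet> db"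
proof -
  have "x \<bullet> (dQ *v d\<^sub>x) = d\<^sub>x \<bullet> (dQ *v x)"
    by (simp only: inner_matrix_vector_transpose [of x] assms inner_commute)
  moreover have "\<eta> \<bullet> (dA *v d\<^sub>x) = d\<^sub>x \<bullet> (transpose dA *v \<eta>)"
    by (simp only: inner_matrix_vector_transpose [of \<eta>] inner_commute)
  ultimately show ?thesis
    by (simp add: kkt_def block_mult_stack stack_add inner_stack inner_outer inner_add_left
        inner_add_right inner_diff_right del: transpose_matrix_vector)
qed

lemma subspace_qp_space: "subspace qp_space"
  by (auto simp: subspace_def qp_space_def transpose_def vec_eq_iff zero_prod_def)

lemma transpose_kkt: "transpose Q = Q \<Longrightarrow> transpose (kkt \<rho> Q A) = kkt \<rho> Q A"
  by (auto simp: kkt_def block_def transpose_def vec_eq_iff mat_def split: sum.split)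

text \<open>Near the base point any implicit fixed point \<open>V\<close> coincides on symmetric data with the explicit
  solution \<open>V0\<close>. The latter is differentiable in all directions, hence its derivative is unique
  and can be computed from the linear system before restricting to symmetric data.\<close>

lemma implicit_fixed_point_has_gradients:
  fixes Q :: "real ^ 'n ^ 'n" and A :: "real ^ 'n ^ 'm"
  assumes Q: "transpose Q = Q"
    and K: "invertible (kkt \<rho> Q A)"
    and M: "invertible (residual_matrix \<rho> (box_proj_deriv l u v) Q A)"
    and fixed: "admm_map \<rho> l u (Q, p, A, b) (stack v \<eta>) = stack v \<eta>"
    and off: "\<forall>j. v $ j \<notin> {l $ j, u $ j}"
    and loss: "GDERIV loss (box_proj l u v) :> g"
    and adj: "transpose (residual_matrix \<rho> (box_proj_deriv l u v) Q A) *v stack d\<^sub>x d\<^sub>\<eta>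
                = block (box_proj_deriv l u v) 0 0 (mat 1) *v stack (- g) 0"
    and V: "implicit_fixed_point \<rho> l u (Q, p, A, b) (stack v \<eta>) U V"
  defines "x \<equiv> box_proj l u v"
  shows "has_qp_gradients (\<lambda>\<theta>. loss (box_proj l u (upper (V \<theta>)))) (Q, p, A, b)
           ((1 / 2) *\<^sub>R (outer d\<^sub>x x + outer x d\<^sub>x)) d\<^sub>x (outer d\<^sub>\<eta> x + outer \<eta> d\<^sub>x) (- d\<^sub>\<eta>)"
proof -
  let ?\<theta> = "(Q, p, A, b)"
  define D where "D = box_proj_deriv l u v"
  define c where "c = x - D *v v"
  obtain U0 W V0 where U0: "open U0" "?\<theta> \<in> U0" and W: "open W" "stack v \<eta> \<in> W"
    and V0: "V0 ?\<theta> = stack v \<eta>" "\<And>\<theta>. \<theta> \<in> U0 \<Longrightarrow> V0 differentiable (at \<theta>)"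
      "\<And>\<theta>. \<theta> \<in> U0 \<Longrightarrow> V0 \<theta> \<in> W"
    and char: "\<And>\<theta> w. \<theta> \<in> U0 \<Longrightarrow> w \<in> W \<Longrightarrow> admm_map \<rho> l u \<theta> w = w \<longleftrightarrow> w = V0 \<theta>"
    and affine: "\<And>w. w \<in> W \<Longrightarrow> box_proj l u (upper w) = c + D *v upper w"
    and resid: "\<And>\<theta>. \<theta> \<in> U0 \<Longrightarrow> residual_matrix \<rho> D (fst \<theta>) (fst (snd (snd \<theta>))) *v V0 \<theta>
          + residual_offset \<rho> c \<theta> = 0"
    by (rule admm_fixed_point_locally_solvable
        [OF K M fixed off, folded D_def, folded x_def, folded c_def]) (rule that)
  obtain V0' where V0': "(V0 has_derivative V0') (at ?\<theta>)"
    using V0(2) [OF U0(2)] unfolding differentiable_def by blast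
  have cDv: "c + D *v v = x" by (simp add: c_def)
  have lin: "residual_matrix \<rho> D Q A *v V0' h
      = - (kkt 0 (fst h) (fst (snd (snd h))) *v stack x \<eta> + stack (fst (snd h)) (- snd (snd (snd h))))" for h
  proof -
    have "((\<lambda>\<theta>. 0) has_derivative (\<lambda>h. residual_matrix \<rho> D Q A *v V0' h
          + kkt 0 (fst h) (fst (snd (snd h))) *v stack x \<eta>
          + stack (fst (snd h)) (- snd (snd (snd h))))) (at ?\<theta>)"
      using has_derivative_transform_within_open
        [OF residual_has_derivative [OF V0', of \<rho> D c] U0 resid]
      by (simp add: V0(1) cDv)
    from fun_cong [OF has_derivative_unique [OF this has_derivative_const], of h]
    show ?thesis by (simp only: eq_neg_iff_add_eq_0 add.assoc)
  qed
  let ?f0 = "\<lambda>\<theta>. loss (c + D *v upper (V0 \<theta>))"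
  have "((\<lambda>\<theta>. D *v upper (V0 \<theta>)) has_derivative (\<lambda>h. D *v upper (V0' h))) (at ?\<theta>)"
    by (intro bounded_linear.has_derivative [OF matrix_vector_mul_bounded_linear]
        bounded_linear.has_derivative [OF bounded_linear_upper] V0')
  then have "((\<lambda>\<theta>. c + D *v upper (V0 \<theta>)) has_derivative (\<lambda>h. D *v upper (V0' h))) (at ?\<theta>)"
    using has_derivative_add [OF has_derivative_const] by force
  moreover have "(loss has_derivative (\<lambda>h. h \<bullet> g)) (at (c + D *v upper (V0 ?\<theta>)))"
    using loss by (simp add: gderiv_def V0(1) cDv x_def)
  ultimately have "(?f0 has_derivative (\<lambda>h. (D *v upper (V0' h)) \<bullet> g)) (at ?\<theta>)"
    by (rule has_derivative_compose)
  then have f0: "(?f0 has_derivative (\<lambda>h. (D *v upper (V0' h)) \<bullet> g)) (at ?\<theta> within qp_space)"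
    by (rule has_derivative_at_withinI)
  have D: "transpose D = D" by (simp add: D_def transpose_box_proj_deriv)
  have \<theta>: "?\<theta> \<in> qp_space" using Q by (simp add: qp_space_def)
  let ?G = "\<lambda>(dQ, dp, dA, db). ((1 / 2) *\<^sub>R (outer d\<^sub>x x + outer x d\<^sub>x)) \<bullet> dQ + d\<^sub>x \<bullet> dp
      + (outer d\<^sub>\<eta> x + outer \<eta> d\<^sub>x) \<bullet> dA + (- d\<^sub>\<eta>) \<bullet> db"
  have fG: "(?f0 has_derivative ?G) (at ?\<theta> within qp_space)"
  proof (rule has_derivative_within_subspace_cong [OF f0 subspace_qp_space \<theta>])
    show "bounded_linear ?G"
      unfolding case_prod_unfold
      by (intro bounded_linear_add bounded_linear_inner_right_comp bounded_linear_fst_comp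
          bounded_linear_snd_comp bounded_linear_ident)
    fix h :: "('n, 'm) qp_data" assume "h \<in> qp_space"
    then obtain dQ dp dA db where h: "h = (dQ, dp, dA, db)" and "transpose dQ = dQ"
      by (auto simp: qp_space_def)
    have "(D *v upper (V0' h)) \<bullet> g
        = stack d\<^sub>x d\<^sub>\<eta> \<bullet> (kkt 0 dQ dA *v stack x \<eta> + stack dp (- db))"
      by (rule adjoint_state_identity [OF adj [folded D_def] _ D]) (simp add: lin h)
    then show "(D *v upper (V0' h)) \<bullet> g = ?G h"
      by (simp only: h prod.case gradients_inner [OF \<open>transpose dQ = dQ\<close>])
  qed
  have V_props: "open U" "?\<theta> \<in> U" "V ?\<theta> = stack v \<eta>" "V differentiable_on (U \<inter> qp_space)"
    and V_fixed: "\<And>\<theta>. \<theta> \<in> U \<inter> qp_space \<Longrightarrow> admm_map \<rho> l u \<theta> (V \<theta>) - V \<theta> = 0"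
    using V unfolding implicit_fixed_point_def by blast+
  \<comment> \<open>Continuity keeps \<open>V\<close> in the region where the fixed point is unique, so \<open>V\<close> agrees with \<open>V0\<close>.\<close>
  have "continuous_on (U \<inter> qp_space) V"
    by (rule differentiable_imp_continuous_on) (rule V_props)
  then obtain T where T: "open T" "T \<inter> (U \<inter> qp_space) = V -` W \<inter> (U \<inter> qp_space)"
    using W(1) unfolding continuous_on_open_invariant by metis
  have "((\<lambda>\<theta>. loss (box_proj l u (upper (V \<theta>)))) has_derivative ?G) (at ?\<theta> within qp_space)"
  proof -
    let ?N = "T \<inter> U \<inter> U0"
    have N: "open ?N" "?\<theta> \<in> ?N"
      using T V_props U0 W \<theta> by auto
    obtain e where e: "e > 0" "ball ?\<theta> e \<subseteq> ?N"
      using N openE by blast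
    have "?f0 \<theta> = loss (box_proj l u (upper (V \<theta>)))" if "\<theta> \<in> qp_space" "dist \<theta> ?\<theta> < e" for \<theta>
    proof -
      have "\<theta> \<in> ?N" using that(2) e(2) by (auto simp: dist_commute)
      then have "V \<theta> \<in> W" "\<theta> \<in> U0" "\<theta> \<in> U \<inter> qp_space" using T(2) that(1) by auto
      moreover have "admm_map \<rho> l u \<theta> (V \<theta>) = V \<theta>"
        using V_fixed [OF \<open>\<theta> \<in> U \<inter> qp_space\<close>] by simp
      ultimately have "V \<theta> = V0 \<theta>" using char by blast
      then show ?thesis using affine [OF \<open>V \<theta> \<in> W\<close>] by simp
    qed
    from has_derivative_transform_within [OF fG e(1) \<theta> this] show ?thesis .
  qed
  moreover have "transpose ((1 / 2) *\<^sub>R (outer d\<^sub>x x + outer x d\<^sub>x))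
      = (1 / 2) *\<^sub>R (outer d\<^sub>x x + outer x d\<^sub>x)"
    by (simp add: outer_def transpose_def vec_eq_iff algebra_simps)
  ultimately show ?thesis
    unfolding has_qp_gradients_def by blast
qed

theorem proposition2:
  fixes Q :: "real ^ 'n ^ 'n" and p l u :: "real ^ 'n"
    and A :: "real ^ 'n ^ 'm" and b :: "real ^ 'm" and \<rho> :: real
    and v x d\<^sub>x :: "real ^ 'n" and \<eta> d\<^sub>\<eta> :: "real ^ 'm"
    and K :: "real ^ ('n + 'm) ^ ('n + 'm)" and D :: "real ^ 'n ^ 'n"
    and loss :: "real ^ 'n \<Rightarrow> real" and grad_loss :: "real ^ 'n \<Rightarrow> real ^ 'n"
  assumes "symmetric_pos_def Q"
    and "\<forall>j. l $ j \<le> u $ j"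
    and "\<rho> > 0"
    and "K = kkt \<rho> Q A" and "invertible K"
    and "admm_map \<rho> l u (Q, p, A, b) (stack v \<eta>) = stack v \<eta>"
    and "x = box_proj l u v" and "D = box_proj_deriv l u v"
    and "\<forall>j. v $ j \<notin> {l $ j, u $ j}"
    and "invertible (mat 1 - admm_jacobian \<rho> l u (Q, p, A, b) (stack v \<eta>))"
    and "\<And>z. GDERIV loss z :> grad_loss z" and "continuous_on UNIV grad_loss"
    and "stack d\<^sub>x d\<^sub>\<eta> =
           matrix_inv K
           *v (transpose (matrix_inv (mat 1 - admm_jacobian \<rho> l u (Q, p, A, b) (stack v \<eta>)))
           *v (block D 0 0 (mat 1) *v stack (- grad_loss x) 0))"
  shows "invertible (block D 0 0 (mat 1) ** K + block (- (\<rho> *\<^sub>R (2 *\<^sub>R D - mat 1))) 0 0 0) \<and>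
         stack d\<^sub>x d\<^sub>\<eta> =
           matrix_inv (block D 0 0 (mat 1) ** K + block (- (\<rho> *\<^sub>R (2 *\<^sub>R D - mat 1))) 0 0 0)
           *v (block D 0 0 (mat 1) *v stack (- grad_loss x) 0) \<and>
         (\<exists>U V. implicit_fixed_point \<rho> l u (Q, p, A, b) (stack v \<eta>) U V) \<and>
         (\<forall>U V. implicit_fixed_point \<rho> l u (Q, p, A, b) (stack v \<eta>) U V \<longrightarrow>
            has_qp_gradients (\<lambda>\<theta>. loss (box_proj l u (upper (V \<theta>)))) (Q, p, A, b)
              ((1 / 2) *\<^sub>R (outer d\<^sub>x x + outer x d\<^sub>x))
              d\<^sub>x
              (outer d\<^sub>\<eta> x + outer \<eta> d\<^sub>x)
              (- d\<^sub>\<eta>))"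
proof -
  let ?\<theta> = "(Q, p, A, b)"
  let ?J = "mat 1 - admm_jacobian \<rho> l u ?\<theta> (stack v \<eta>)"
  let ?M = "residual_matrix \<rho> D Q A"
  let ?N = "block D 0 0 (mat 1) ** K + block (- (\<rho> *\<^sub>R (2 *\<^sub>R D - mat 1))) 0 0 0"
  let ?y = "block D 0 0 (mat 1) *v stack (- grad_loss x) 0 :: real ^ ('n + 'm)"
  have Q: "transpose Q = Q" using assms(1) by (simp add: symmetric_pos_def_def)
  have D: "transpose D = D" by (simp add: assms(8) transpose_box_proj_deriv)
  have K: "invertible (kkt \<rho> Q A)" using assms(4,5) by simp
  have J: "?J = matrix_inv K ** ?M"
    using id_minus_admm_jacobian [OF K] by (simp add: assms(4,8))
  then have "?M = K ** ?J"
    by (simp add: matrix_mul_assoc matrix_inv_right [OF assms(5)])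
  then have M: "invertible ?M"
    using invertible_mult [OF assms(5,10)] by simp
  have N: "?N = transpose ?M"
    using transpose_residual_matrix [OF Q D, of \<rho> A] by (simp add: assms(4))
  then have invN: "invertible ?N"
    using transpose_invertible [OF M] by simp
  have "matrix_inv ?J = matrix_inv ?M ** K"
  proof (rule matrix_inv_unique)
    have "?J ** (matrix_inv ?M ** K) = matrix_inv K ** (?M ** matrix_inv ?M) ** K"
      by (simp only: J matrix_mul_assoc)
    then show "?J ** (matrix_inv ?M ** K) = mat 1"
      by (simp add: matrix_inv_right [OF M] matrix_inv_left [OF assms(5)])
  qed
  moreover have "transpose (matrix_inv ?M) = matrix_inv ?N"
  proof (rule matrix_inv_unique [symmetric])
    show "?N ** transpose (matrix_inv ?M) = mat 1"
      by (simp only: N matrix_transpose_mul [symmetric] matrix_inv_left [OF M] transpose_mat)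
  qed
  ultimately have "transpose (matrix_inv ?J) = K ** matrix_inv ?N"
    by (simp only: matrix_transpose_mul assms(4) transpose_kkt [OF Q])
  then have d: "stack d\<^sub>x d\<^sub>\<eta> = matrix_inv ?N *v ?y"
    using assms(13)
    by (simp only: matrix_vector_mul_assoc matrix_mul_assoc matrix_inv_left [OF assms(5)]
        matrix_mul_lid)
  then have adj: "transpose ?M *v stack d\<^sub>x d\<^sub>\<eta> = ?y"
    using matrix_inv_mult_eq_iff [OF invN] N by metis
  obtain U V where "open U" "?\<theta> \<in> U" and "V ?\<theta> = stack v \<eta>"
    and diff: "\<And>\<theta>. \<theta> \<in> U \<Longrightarrow> V differentiable (at \<theta>)"
    and W: "\<And>\<theta>. \<theta> \<in> U \<Longrightarrow> admm_map \<rho> l u \<theta> (V \<theta>) = V \<theta>"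
    by (rule admm_fixed_point_locally_solvable [OF K M [unfolded assms(8)] assms(6,9)]) metis
  then have "implicit_fixed_point \<rho> l u ?\<theta> (stack v \<eta>) U V"
    unfolding implicit_fixed_point_def
    by (auto intro!: differentiable_at_imp_differentiable_on)
  moreover have "has_qp_gradients (\<lambda>\<theta>. loss (box_proj l u (upper (V \<theta>)))) ?\<theta>
      ((1 / 2) *\<^sub>R (outer d\<^sub>x x + outer x d\<^sub>x)) d\<^sub>x (outer d\<^sub>\<eta> x + outer \<eta> d\<^sub>x) (- d\<^sub>\<eta>)"
    if "implicit_fixed_point \<rho> l u ?\<theta> (stack v \<eta>) U V" for U V
    using implicit_fixed_point_has_gradients [OF Q K M [unfolded assms(8)] assms(6,9)
        assms(11) [of "box_proj l u v"] _ that, folded assms(7) assms(8), OF adj] .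
  ultimately show ?thesis using invN d by blast
qed

end
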